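(* Let $\bm{\mu}=(\mu_1,\dots,\mu_r)$ be probability measures on $\partial\mathbb{D}$, fix a branch of the square root, and let $\bm{n}\in\mathbb{N}^r$ be arbitrary. Put $\ell_j=n_j/2$, $|\bm{\ell}|=|\bm{n}|/2$. Consider the following hybrid approximation problem for a function $\varphi_{\bm{n}}\in\operatorname{span}\{z^k\}_{k=-|\bm{\ell}|}^{|\bm{\ell}|}$, common to all $j$, and functions $\psi_{\bm{n},1},\dots,\psi_{\bm{n},r}$: (i) for every $j$ with $|\bm{n}|-n_j$ even, $\psi_{\bm{n},j}\in\operatorname{span}\{z^k\}_{k=-|\bm{\ell}|}^{|\bm{\ell}|}$ and $$\varphi_{\bm{n}}(z)F_j(z)+\psi_{\bm{n},j}(z)=\mathcal{O}(z^{\ell_j}),\ z\to0,\qquad \varphi_{\bm{n}}(z)F_j(z)+\psi_{\bm{n},j}(z)=\mathcal{O}(z^{-\ell_j-1}),\ z\to\infty;$$ (ii) for every $j$ with $|\bm{n}|-n_j$ odd, $\psi_{\bm{n},j}\in\operatorname{span}\{z^k\}_{k=-|\bm{\ell}|+1/2}^{|\bm{\ell}|-1/2}$ and $$\varphi_{\bm{n}}(z)G_j(z)+\psi_{\bm{n},j}(z)=\mathcal{O}(z^{\ell_j}),\ z\to0,\qquad \varphi_{\bm{n}}(z)G_j(z)+\psi_{\bm{n},j}(z)=\mathcal{O}(z^{-\ell_j-1}),\ z\to\infty.$$ This approximation problem has a unique monic solution $\varphi_{\bm{n}}$ (i.e. with $z^{|\bm{\ell}|}$-coefficient equal to $1$)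 if and only if $\bm{n}$ is $\phi$-normal with respect to $\bm{\mu}$. This solution is then given by $\varphi_{\bm{n}}=\phi_{\bm{n}}$.
   Context: $\mathbb{N}=\{0,1,2,\dots\}$; $\partial\mathbb{D}=\{z\in\mathbb{C}:|z|=1\}$; $|\bm{n}|=n_1+\dots+n_r$. Branch: for a fixed $t_0\in\mathbb{R}$, $z^{1/2}=|z|^{1/2}\exp(\tfrac{i}{2}\arg z)$ with $\arg z\in[t_0,t_0+2\pi)$; for $m\in\mathbb{Z}$, $z^{m/2}:=(z^{1/2})^m$. For $a,b\in\frac12\mathbb{Z}$ with $b-a\in\mathbb{N}$, $\operatorname{span}\{z^k\}_{k=a}^{b}$ denotes the complex span of $z^a,z^{a+1},\dots,z^b$. For $z\in\mathbb{C}\setminus\partial\mathbb{D}$, $$F_j(z)=\int_{\partial\mathbb{D}}\frac{w+z}{w-z}\,d\mu_j(w),\qquad G_j(z)=\int_{\partial\mathbb{D}}\frac{w^{1/2}z^{1/2}}{w-z}\,d\mu_j(w).$$ Normality: $\bm{n}$ is $\phi$-normal with respect to $\bm{\mu}$ if there exists a unique function of the form $$\phi_{\bm{n}}(z)=z^{|\bm{n}|/2}+\kappa_{|\bm{n}|/2-1}z^{|\bm{n}|/2-1}+\dots+\kappa_{-|\bm{n}|/2}z^{-|\bm{n}|/2}$$ (complex coefficients, exponents decreasing in steps of $1$) satisfying, for every $j=1,\dots,r$, $$\int\phi_{\bm{n}}(z)z^{-k}\,d\mu_j(z)=0,\qquad k=-\tfrac{n_j}{2},-\tfrac{n_j}{2}+1,\dots,\tfrac{n_j}{2}-1$$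 (no condition for $j$ if $n_j=0$). The index $\bm{0}$ is normal, with $\phi_{\bm{0}}=1$. *)

theory Defs
  imports "HOL-Probability.Probability" "HOL-Complex_Analysis.Complex_Analysis"
begin

text \<open>
  Half-integers are encoded by their doubles: an integer \<open>m\<close> stands for the exponent
  \<open>m/2\<close>, and steps of size 1 between exponents are steps of size 2 between the codes.
\<close>

definition branch_arg :: "real \<Rightarrow> complex \<Rightarrow> real" where
  "branch_arg t0 z = (THE t. t \<in> {t0..<t0 + 2 * pi} \<and> is_Arg z t)"

text \<open>At \<open>0\<close> the argument is not determined, but the factor \<open>sqrt (cmod z)\<close> vanishes.\<close>

definition branch_sqrt :: "real \<Rightarrow> complex \<Rightarrow> complex" where
  "branch_sqrt t0 z =
     complex_of_real (sqrt (cmod z)) * exp (\<i> / 2 * complex_of_real (branch_arg t0 z))"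

definition half_pow :: "real \<Rightarrow> int \<Rightarrow> complex \<Rightarrow> complex" where
  "half_pow t0 m z = branch_sqrt t0 z powi m"

text \<open>The codes of \<open>a/2, a/2 + 1, \<dots>, b/2\<close>; empty if \<open>b < a\<close>.\<close>

definition half_exps :: "int \<Rightarrow> int \<Rightarrow> int set" where
  "half_exps a b = {m. a \<le> m \<and> m \<le> b \<and> even (m - a)}"

definition half_sum :: "real \<Rightarrow> int \<Rightarrow> int \<Rightarrow> (int \<Rightarrow> complex) \<Rightarrow> complex \<Rightarrow> complex" where
  "half_sum t0 a b c z = (\<Sum>m\<in>half_exps a b. c m * half_pow t0 m z)"

definition half_span :: "real \<Rightarrow> int \<Rightarrow> int \<Rightarrow> (complex \<Rightarrow> complex) set" where
  "half_span t0 a b = range (half_sum t0 a b)"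

definition prob_on_circle :: "complex measure \<Rightarrow> bool" where
  "prob_on_circle M \<longleftrightarrow>
     prob_space M \<and> sets M = sets (restrict_space borel (sphere 0 1))"

definition F_fun :: "complex measure \<Rightarrow> complex \<Rightarrow> complex" where
  "F_fun M z = (\<integral>w. (w + z) / (w - z) \<partial>M)"

definition G_fun :: "real \<Rightarrow> complex measure \<Rightarrow> complex \<Rightarrow> complex" where
  "G_fun t0 M z = (\<integral>w. branch_sqrt t0 w * branch_sqrt t0 z / (w - z) \<partial>M)"

text \<open>
  A finite type \<open>'r\<close> serves as the index set \<open>{1, \<dots>, r}\<close>, where \<open>r = CARD('r)\<close>.
\<close>

definition index_size :: "('r::finite \<Rightarrow> nat) \<Rightarrow> nat" where
  "index_size n = (\<Sum>j\<in>UNIV. n j)"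

definition is_phi :: "real \<Rightarrow> ('r::finite \<Rightarrow> complex measure) \<Rightarrow> ('r \<Rightarrow> nat)
    \<Rightarrow> (complex \<Rightarrow> complex) \<Rightarrow> bool" where
  "is_phi t0 \<mu> n \<phi> \<longleftrightarrow>
     (let N = int (index_size n) in
       (\<exists>\<kappa>. \<phi> = (\<lambda>z. half_pow t0 N z + half_sum t0 (- N) (N - 2) \<kappa> z))) \<and>
     (\<forall>j. \<forall>k\<in>half_exps (- int (n j)) (int (n j) - 2).
        (\<integral>z. \<phi> z * half_pow t0 (- k) z \<partial>\<mu> j) = 0)"

definition phi_normal :: "real \<Rightarrow> ('r::finite \<Rightarrow> complex measure) \<Rightarrow> ('r \<Rightarrow> nat) \<Rightarrow> bool" where
  "phi_normal t0 \<mu> n \<longleftrightarrow> (\<exists>!\<phi>. is_phi t0 \<mu> n \<phi>)"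

text \<open>Meaningful only for normal indices.\<close>

definition phi_fun :: "real \<Rightarrow> ('r::finite \<Rightarrow> complex measure) \<Rightarrow> ('r \<Rightarrow> nat)
    \<Rightarrow> complex \<Rightarrow> complex" where
  "phi_fun t0 \<mu> n = (THE \<phi>. is_phi t0 \<mu> n \<phi>)"

definition hybrid_solution :: "real \<Rightarrow> ('r::finite \<Rightarrow> complex measure) \<Rightarrow> ('r \<Rightarrow> nat)
    \<Rightarrow> (complex \<Rightarrow> complex) \<Rightarrow> ('r \<Rightarrow> complex \<Rightarrow> complex) \<Rightarrow> bool" where
  "hybrid_solution t0 \<mu> n \<phi> \<psi> \<longleftrightarrow>
     (let N = int (index_size n) in
       \<phi> \<in> half_span t0 (- N) N \<and>
       (\<forall>j. even (N - int (n j)) \<longrightarrow>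
          \<psi> j \<in> half_span t0 (- N) N \<and>
          (\<lambda>z. \<phi> z * F_fun (\<mu> j) z + \<psi> j z) \<in> O[at 0](half_pow t0 (int (n j))) \<and>
          (\<lambda>z. \<phi> z * F_fun (\<mu> j) z + \<psi> j z)
            \<in> O[at_infinity](half_pow t0 (- int (n j) - 2))) \<and>
       (\<forall>j. odd (N - int (n j)) \<longrightarrow>
          \<psi> j \<in> half_span t0 (- N + 1) (N - 1) \<and>
          (\<lambda>z. \<phi> z * G_fun t0 (\<mu> j) z + \<psi> j z) \<in> O[at 0](half_pow t0 (int (n j))) \<and>
          (\<lambda>z. \<phi> z * G_fun t0 (\<mu> j) z + \<psi> j z)
            \<in> O[at_infinity](half_pow t0 (- int (n j) - 2))))"

definition half_monic :: "real \<Rightarrow> nat \<Rightarrow> (complex \<Rightarrow> complex) \<Rightarrow> bool" where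
  "half_monic t0 N \<phi> \<longleftrightarrow> (\<exists>c. \<phi> = half_sum t0 (- int N) (int N) c \<and> c (int N) = 1)"

definition monic_hybrid_solution :: "real \<Rightarrow> ('r::finite \<Rightarrow> complex measure) \<Rightarrow> ('r \<Rightarrow> nat)
    \<Rightarrow> (complex \<Rightarrow> complex) \<Rightarrow> bool" where
  "monic_hybrid_solution t0 \<mu> n \<phi> \<longleftrightarrow>
     half_monic t0 (index_size n) \<phi> \<and> (\<exists>\<psi>. hybrid_solution t0 \<mu> n \<phi> \<psi>)"

end

theory Submission
  imports Defs
begin

text \<open>
  Expand \<open>\<phi> F\<^sub>j\<close> (or \<open>\<phi> G\<^sub>j\<close>) in half-integer powers of \<open>z\<close> at \<open>0\<close> and at \<open>\<infinity>\<close>. The condition at \<open>0\<close>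
  determines the coefficients of \<open>\<psi>\<^sub>j\<close> at the exponents below \<open>n\<^sub>j / 2\<close>, the condition at \<open>\<infinity>\<close> those
  at the exponents from \<open>- n\<^sub>j / 2\<close> on. Together they determine all of \<open>\<psi>\<^sub>j\<close>, and they are
  compatible if and only if the two expansions agree at the exponents \<open>k = - n\<^sub>j / 2, \<dots>, n\<^sub>j / 2 - 1\<close>.
  The two \<open>k\<close>-th coefficients differ by a nonzero multiple of the integral of \<open>\<phi>(w) w\<^sup>-\<^sup>k\<close>, so
  compatibility is exactly the orthogonality that defines \<open>\<phi>\<^sub>n\<close>. The branch cut is harmless
  because only \<open>(z\<^sup>1\<^sup>/\<^sup>2)\<^sup>2 = z\<close> and the size of \<open>z\<^sup>1\<^sup>/\<^sup>2\<close> matter.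
\<close>

section \<open>The branch of the square root: closed form, modulus, measurability\<close>

text \<open>Multiplication by exp(-i t0) rotates the window [t0, t0 + 2 pi) to [0, 2 pi), where
  \<open>Arg2pi\<close> is the unique argument. This gives a closed form for an argument defined by
  description.\<close>

lemma branch_arg_eq:
  assumes "z \<noteq> 0"
  shows "branch_arg t0 z = t0 + Arg2pi (z * exp (- \<i> * of_real t0))"
proof -
  define u where "u = z * exp (- \<i> * of_real t0)"
  have norm_u: "cmod u = cmod z" by (simp add: u_def norm_mult)
  have z: "z = u * exp (\<i> * of_real t0)" by (simp add: u_def flip: exp_add)
  have arg_iff: "is_Arg z t \<longleftrightarrow> is_Arg u (t - t0)" for t
    unfolding is_Arg_def norm_u
    by (subst z) (simp add: algebra_simps exp_diff nonzero_eq_divide_eq)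
  show ?thesis
    unfolding branch_arg_def u_def[symmetric]
  proof (rule the_equality)
    show "t0 + Arg2pi u \<in> {t0..<t0 + 2 * pi} \<and> is_Arg z (t0 + Arg2pi u)"
      using Arg2pi[of u] by (simp add: arg_iff)
  next
    fix t assume t: "t \<in> {t0..<t0 + 2 * pi} \<and> is_Arg z t"
    then have "u = of_real (cmod u) * exp (\<i> * of_real (t - t0))"
      using arg_iff[of t] by (simp add: is_Arg_def)
    from Arg2pi_unique[OF this[symmetric]] have "Arg2pi u = t - t0"
      using assms t norm_u by simp
    then show "t = t0 + Arg2pi u" by simp
  qed
qed

lemma branch_sqrt_eq:
  "branch_sqrt t0 z = of_real (sqrt (cmod z)) *
     exp (\<i> / 2 * of_real (t0 + Arg2pi (z * exp (- \<i> * of_real t0))))"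
  by (cases "z = 0") (simp_all add: branch_sqrt_def branch_arg_eq)

lemma branch_sqrt_power2 [simp]: "(branch_sqrt t0 z)\<^sup>2 = z"
proof -
  define u where "u = z * exp (- \<i> * of_real t0)"
  have "(branch_sqrt t0 z)\<^sup>2 = of_real (cmod u) * exp (\<i> * of_real (Arg2pi u)) * exp (\<i> * of_real t0)"
    unfolding branch_sqrt_eq u_def[symmetric]
    by (simp add: power_mult_distrib u_def norm_mult flip: exp_double exp_add of_real_power)
       (simp add: algebra_simps)
  also have "of_real (cmod u) * exp (\<i> * of_real (Arg2pi u)) = u"
    using Arg2pi_eq[of u] by simp
  finally show ?thesis by (simp add: u_def mult.assoc flip: exp_add)
qed

lemma norm_branch_sqrt [simp]: "cmod (branch_sqrt t0 z) = sqrt (cmod z)"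
  by (simp add: branch_sqrt_def norm_mult)

lemma branch_sqrt_eq_0_iff [simp]: "branch_sqrt t0 z = 0 \<longleftrightarrow> z = 0"
  by (metis norm_branch_sqrt norm_eq_zero real_sqrt_eq_zero_cancel_iff)

text \<open>\<open>Arg2pi\<close> is continuous off the closed half-line of nonnegative reals and
  equals 0 on it, so it coincides with its own cut-off by the indicator of the open
  complement.\<close>

lemma borel_measurable_Arg2pi: "Arg2pi \<in> borel_measurable borel"
proof -
  have "continuous_on (- \<real>\<^sub>\<ge>\<^sub>0) Arg2pi"
    by (intro continuous_at_imp_continuous_on) (auto intro: continuous_at_Arg2pi)
  then have "(\<lambda>u. indicator (- \<real>\<^sub>\<ge>\<^sub>0) u *\<^sub>R Arg2pi u) \<in> borel_measurable borel"
    by (intro borel_measurable_continuous_on_indicator) auto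
  also have "(\<lambda>u. indicator (- \<real>\<^sub>\<ge>\<^sub>0) u *\<^sub>R Arg2pi u) = Arg2pi"
    by (auto simp: indicator_def Arg2pi_eq_0 complex_nonneg_Reals_iff complex_is_Real_iff)
  finally show ?thesis .
qed

lemma borel_measurable_branch_sqrt [measurable]: "branch_sqrt t0 \<in> borel_measurable borel"
  unfolding branch_sqrt_eq[abs_def]
  by (measurable, rule measurable_compose[OF _ borel_measurable_Arg2pi], measurable)

section \<open>Geometric sums and growth orders of half-integer powers\<close>

lemma finite_half_exps [simp]: "finite (half_exps a b)"
  by (rule finite_subset[of _ "{a..b}"]) (auto simp: half_exps_def)

text \<open>Each summand is a difference of consecutive terms x^q y^(2-q) / (y^2 - x^2), with q
  going up by 2. With the square roots of z and w for x and y the denominator becomes w - z, that of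
  the Cauchy kernel.\<close>

lemma half_exps_telescope:
  fixes x y :: complex
  assumes "x \<noteq> 0" "y \<noteq> 0" "y\<^sup>2 \<noteq> x\<^sup>2" "p \<le> r" "even (r - p)"
  shows "(\<Sum>q\<in>half_exps p (r - 2). x powi q * y powi (- q)) =
    (x powi p * y powi (2 - p) - x powi r * y powi (2 - r)) / (y\<^sup>2 - x\<^sup>2)"
proof -
  have "(\<Sum>q\<in>half_exps p (p + 2 * int k - 2). x powi q * y powi (- q)) =
    (x powi p * y powi (2 - p) - x powi (p + 2 * int k) * y powi (2 - (p + 2 * int k))) / (y\<^sup>2 - x\<^sup>2)" for k
  proof (induction k)
    case 0
    have "half_exps p (p - 2) = {}" by (auto simp: half_exps_def)
    then show ?case by simp
  next
    case (Suc k)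
    define q where "q = p + 2 * int k"
    have "half_exps p (p + 2 * int (Suc k) - 2) = insert q (half_exps p (q - 2))"
      unfolding half_exps_def q_def by (auto; presburger)
    moreover have "q \<notin> half_exps p (q - 2)" by (simp add: half_exps_def)
    moreover have "x powi q * y powi (- q) =
        (x powi q * y powi (2 - q) - x powi (q + 2) * y powi (2 - (q + 2))) / (y\<^sup>2 - x\<^sup>2)"
      using assms by (simp add: power_int_add power_int_diff power_int_minus field_simps)
    ultimately have "(\<Sum>q\<in>half_exps p (p + 2 * int (Suc k) - 2). x powi q * y powi (- q)) =
        (x powi q * y powi (2 - q) - x powi (q + 2) * y powi (2 - (q + 2))) / (y\<^sup>2 - x\<^sup>2) +
        (x powi p * y powi (2 - p) - x powi q * y powi (2 - q)) / (y\<^sup>2 - x\<^sup>2)"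
      using Suc by (simp only: q_def[symmetric] sum.insert finite_half_exps simp_thms)
    also have "\<dots> = (x powi p * y powi (2 - p) - x powi (q + 2) * y powi (2 - (q + 2))) / (y\<^sup>2 - x\<^sup>2)"
      by (simp add: diff_divide_distrib)
    also have "q + 2 = p + 2 * int (Suc k)" by (simp add: q_def)
    finally show ?case .
  qed
  \<comment> \<open>\<open>p \<le> r\<close> and the parity of \<open>r - p\<close> make the number
    of summands a natural number.\<close>
  from this[of "nat ((r - p) div 2)"] assms show ?thesis by simp
qed

text \<open>General in \<open>t\<close> and the filter because it serves twice: for the square root
  at 0 and for its reciprocal at infinity.\<close>

lemma powi_bigo_powi:
  fixes t :: "'a \<Rightarrow> complex"
  assumes "(t \<longlongrightarrow> 0) F" "\<forall>\<^sub>F x in F. t x \<noteq> 0" "p \<le> i"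
  shows "(\<lambda>x. t x powi i) \<in> O[F](\<lambda>x. t x powi p)"
proof -
  have "\<forall>\<^sub>F x in F. norm (t x) < 1"
    using tendstoD[OF assms(1), of 1] by simp
  with assms(2) have "\<forall>\<^sub>F x in F. norm (t x powi i) \<le> 1 * norm (t x powi p)"
    by eventually_elim (auto simp: norm_power_int assms intro!: power_int_decreasing)
  then show ?thesis by (rule bigoI)
qed

text \<open>Divided by the lowest power with a nonzero coefficient, the sum tends to that
  coefficient. If that power is below \<open>p\<close>, the growth bound makes the same quotient
  tend to 0, a contradiction.\<close>

lemma powi_sum_bigo_imp_coeff_0:
  fixes t :: "'a \<Rightarrow> complex"
  assumes t: "(t \<longlongrightarrow> 0) F" "\<forall>\<^sub>F x in F. t x \<noteq> 0" and "F \<noteq> bot" "finite I"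
    and O: "(\<lambda>x. \<Sum>i\<in>I. c i * t x powi i) \<in> O[F](\<lambda>x. t x powi p)"
    and "i \<in> I" "i < p"
  shows "c i = 0"
proof (rule ccontr)
  assume "c i \<noteq> 0"
  define J where "J = {i\<in>I. c i \<noteq> 0}"
  define k where "k = Min J"
  have J: "finite J" "i \<in> J" using assms \<open>c i \<noteq> 0\<close> by (auto simp: J_def)
  then have k: "k \<in> J" "k \<le> i" "\<And>j. j \<in> J \<Longrightarrow> k \<le> j" by (auto simp: k_def intro: Min_in)
  have lim: "((\<lambda>x. t x powi m) \<longlongrightarrow> 0) F" if "m > 0" for m
  proof -
    have "((\<lambda>x. t x ^ nat m) \<longlongrightarrow> 0 ^ nat m) F" by (intro tendsto_intros t)
    with that show ?thesis by (simp add: power_int_def zero_power)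
  qed
  have "((\<lambda>x. c k + (\<Sum>j\<in>J - {k}. c j * t x powi (j - k))) \<longlongrightarrow> c k + (\<Sum>j\<in>J - {k}. c j * 0)) F"
  proof (intro tendsto_intros lim)
    fix j assume "j \<in> J - {k}"
    with k(3)[of j] show "0 < j - k" by auto
  qed
  moreover have "\<forall>\<^sub>F x in F. c k + (\<Sum>j\<in>J - {k}. c j * t x powi (j - k)) =
      (\<Sum>i\<in>I. c i * t x powi i) / t x powi k"
    using t(2)
  proof eventually_elim
    case (elim x)
    have "(\<Sum>i\<in>I. c i * t x powi i) = (\<Sum>i\<in>J. c i * t x powi i)"
      by (rule sum.mono_neutral_right) (use assms in \<open>auto simp: J_def\<close>)
    also have "\<dots> / t x powi k = (\<Sum>i\<in>J. c i * t x powi (i - k))"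
      using elim by (simp add: sum_divide_distrib power_int_diff)
    also have "\<dots> = c k + (\<Sum>j\<in>J - {k}. c j * t x powi (j - k))"
      using J k by (subst sum.remove[of J k]) auto
    finally show ?case by simp
  qed
  ultimately have 1: "((\<lambda>x. (\<Sum>i\<in>I. c i * t x powi i) / t x powi k) \<longlongrightarrow> c k) F"
    by (simp add: tendsto_cong)
  have "(\<lambda>x. t x powi p) \<in> o[F](\<lambda>x. t x powi k)"
  proof (rule smalloI_tendsto)
    have "\<forall>\<^sub>F x in F. t x powi (p - k) = t x powi p / t x powi k"
      using t(2) by eventually_elim (simp add: power_int_diff)
    moreover have "((\<lambda>x. t x powi (p - k)) \<longlongrightarrow> 0) F" using k \<open>i < p\<close> by (intro lim) auto
    ultimately show "((\<lambda>x. t x powi p / t x powi k) \<longlongrightarrow> 0) F" by (simp add: tendsto_cong)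
    show "\<forall>\<^sub>F x in F. t x powi k \<noteq> 0" using t(2) by eventually_elim auto
  qed
  with O have "(\<lambda>x. \<Sum>i\<in>I. c i * t x powi i) \<in> o[F](\<lambda>x. t x powi k)"
    by (rule landau_o.big_small_trans)
  then have "((\<lambda>x. (\<Sum>i\<in>I. c i * t x powi i) / t x powi k) \<longlongrightarrow> 0) F"
    by (rule smalloD_tendsto)
  with 1 \<open>F \<noteq> bot\<close> have "c k = 0" using tendsto_unique by blast
  with k show False by (simp add: J_def)
qed

lemma branch_sqrt_at_0:
  "(branch_sqrt t0 \<longlongrightarrow> 0) (at 0)" "\<forall>\<^sub>F z in at 0. branch_sqrt t0 z \<noteq> 0"
proof -
  have "((\<lambda>z. sqrt (cmod z)) \<longlongrightarrow> sqrt (cmod 0)) (at 0)" by (intro tendsto_intros)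
  then have "((\<lambda>z. norm (branch_sqrt t0 z)) \<longlongrightarrow> 0) (at 0)" by simp
  then show "(branch_sqrt t0 \<longlongrightarrow> 0) (at 0)" by (rule tendsto_norm_zero_cancel)
  show "\<forall>\<^sub>F z in at 0. branch_sqrt t0 z \<noteq> 0" by (simp add: eventually_at_filter)
qed

lemma inverse_branch_sqrt_at_infinity:
  "((\<lambda>z. inverse (branch_sqrt t0 z)) \<longlongrightarrow> 0) at_infinity"
  "\<forall>\<^sub>F z in at_infinity. inverse (branch_sqrt t0 z) \<noteq> 0"
proof -
  have "filterlim (\<lambda>z. sqrt (cmod z)) at_top at_infinity"
    by (rule filterlim_compose[OF sqrt_at_top filterlim_norm_at_top])
  then have "filterlim (branch_sqrt t0) at_infinity at_infinity"
    by (intro filterlim_norm_at_top_imp_at_infinity) simp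
  then show "((\<lambda>z. inverse (branch_sqrt t0 z)) \<longlongrightarrow> 0) at_infinity"
    by (rule filterlim_compose[OF tendsto_inverse_0])
  show "\<forall>\<^sub>F z in at_infinity. inverse (branch_sqrt t0 z) \<noteq> 0"
    by (simp add: eventually_not_equal_at_infinity)
qed

lemma half_pow_bigo_at_0:
  "p \<le> i \<Longrightarrow> half_pow t0 i \<in> O[at 0](half_pow t0 p)"
  using powi_bigo_powi[OF branch_sqrt_at_0] by (simp add: half_pow_def[abs_def])

lemma half_pow_eq_inverse: "half_pow t0 m z = inverse (branch_sqrt t0 z) powi (- m)"
  by (simp add: half_pow_def power_int_minus power_int_inverse)

lemma half_pow_bigo_at_infinity:
  "i \<le> p \<Longrightarrow> half_pow t0 i \<in> O[at_infinity](half_pow t0 p)"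
  using powi_bigo_powi[OF inverse_branch_sqrt_at_infinity, of "- p" "- i"]
  by (simp add: half_pow_eq_inverse[abs_def])

text \<open>Turns a growth condition into linear conditions on coefficients, the form in which the
  conditions on psi are solved later.\<close>

lemma half_sum_bigo_at_0_iff:
  "half_sum t0 a b c \<in> O[at 0](half_pow t0 p) \<longleftrightarrow> (\<forall>i\<in>half_exps a b. i < p \<longrightarrow> c i = 0)"
proof (intro iffI ballI impI)
  fix i assume "half_sum t0 a b c \<in> O[at 0](half_pow t0 p)" "i \<in> half_exps a b" "i < p"
  then show "c i = 0"
    by (intro powi_sum_bigo_imp_coeff_0[OF branch_sqrt_at_0, where I = "half_exps a b"])
       (simp_all add: half_sum_def[abs_def] half_pow_def[abs_def])
next
  assume c: "\<forall>i\<in>half_exps a b. i < p \<longrightarrow> c i = 0"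
  have "(\<lambda>z. c i * half_pow t0 i z) \<in> O[at 0](half_pow t0 p)" if "i \<in> half_exps a b" for i
    using c that half_pow_bigo_at_0[of p i t0] by (cases "i < p") auto
  then show "half_sum t0 a b c \<in> O[at 0](half_pow t0 p)"
    unfolding half_sum_def[abs_def] by (rule big_sum_in_bigo)
qed

lemma half_sum_bigo_at_infinity_iff:
  "half_sum t0 a b c \<in> O[at_infinity](half_pow t0 p) \<longleftrightarrow> (\<forall>i\<in>half_exps a b. p < i \<longrightarrow> c i = 0)"
proof (intro iffI ballI impI)
  fix i assume *: "half_sum t0 a b c \<in> O[at_infinity](half_pow t0 p)" "i \<in> half_exps a b" "p < i"
  \<comment> \<open>Reflecting the index writes the sum in powers of the reciprocal square root, so
    the highest exponents become the lowest.\<close>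
  have "half_sum t0 a b c =
      (\<lambda>z. \<Sum>i\<in>uminus ` half_exps a b. c (- i) * inverse (branch_sqrt t0 z) powi i)"
    by (subst sum.reindex) (auto simp: half_sum_def half_pow_eq_inverse)
  with *(1) have "(\<lambda>z. \<Sum>i\<in>uminus ` half_exps a b. c (- i) * inverse (branch_sqrt t0 z) powi i)
      \<in> O[at_infinity](\<lambda>z. inverse (branch_sqrt t0 z) powi (- p))"
    by (simp add: half_pow_eq_inverse[abs_def])
  then have "c (- (- i)) = 0"
    by (rule powi_sum_bigo_imp_coeff_0[OF inverse_branch_sqrt_at_infinity, rotated 2])
       (use * in \<open>auto simp: trivial_limit_at_infinity\<close>)
  then show "c i = 0" by simp
next
  assume c: "\<forall>i\<in>half_exps a b. p < i \<longrightarrow> c i = 0"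
  have "(\<lambda>z. c i * half_pow t0 i z) \<in> O[at_infinity](half_pow t0 p)" if "i \<in> half_exps a b" for i
    using c that half_pow_bigo_at_infinity[of i p t0] by (cases "p < i") auto
  then show "half_sum t0 a b c \<in> O[at_infinity](half_pow t0 p)"
    unfolding half_sum_def[abs_def] by (rule big_sum_in_bigo)
qed

section \<open>Moments and Cauchy transforms of measures on the circle\<close>

lemma norm_half_pow: "cmod (half_pow t0 m z) = sqrt (cmod z) powi m"
  by (simp add: half_pow_def norm_power_int)

lemma half_pow_0 [simp]: "half_pow t0 0 z = 1"
  by (simp add: half_pow_def)

lemma half_pow_add: "z \<noteq> 0 \<Longrightarrow> half_pow t0 (a + b) z = half_pow t0 a z * half_pow t0 b z"
  by (simp add: half_pow_def power_int_add)

lemma half_pow_2: "half_pow t0 2 z = z"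
  by (simp add: half_pow_def)

lemma half_pow_minus_2: "half_pow t0 (- 2) z = inverse z"
  by (simp add: half_pow_def power_int_minus)

lemma borel_measurable_half_pow [measurable]: "half_pow t0 m \<in> borel_measurable borel"
  unfolding half_pow_def[abs_def] power_int_def by (cases "m \<ge> 0") simp_all

definition half_moment :: "real \<Rightarrow> complex measure \<Rightarrow> int \<Rightarrow> complex" where
  "half_moment t0 M m = (\<integral>w. half_pow t0 m w \<partial>M)"

text \<open>The Cauchy transform of the complex measure w^(m/2) dM. The function G is z^(1/2) times
  the case \<open>m = 1\<close>, and F is affine in z times the case \<open>m = 0\<close>.\<close>

definition half_cauchy :: "real \<Rightarrow> complex measure \<Rightarrow> int \<Rightarrow> complex \<Rightarrow> complex" where
  "half_cauchy t0 M m z = (\<integral>w. half_pow t0 m w / (w - z) \<partial>M)"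

context
  fixes M :: "complex measure"
  assumes M: "prob_on_circle M"
begin

interpretation prob_space M
  using M by (simp add: prob_on_circle_def)

lemma norm_eq_1_of_space: "w \<in> space M \<Longrightarrow> cmod w = 1"
proof -
  have "sets M = sets (restrict_space borel (sphere 0 1))" using M by (simp add: prob_on_circle_def)
  then have "space M = sphere 0 1" by (simp add: sets_eq_imp_space_eq space_restrict_space)
  then show "w \<in> space M \<Longrightarrow> cmod w = 1" by simp
qed

lemma borel_measurable_circle: "f \<in> borel_measurable borel \<Longrightarrow> f \<in> borel_measurable M"
proof -
  have "sets M = sets (restrict_space borel (sphere 0 1))" using M by (simp add: prob_on_circle_def)
  then have "measurable M borel = measurable (restrict_space borel (sphere 0 1)) borel"
    by (rule measurable_cong_sets) simp
  then show "f \<in> borel_measurable borel \<Longrightarrow> f \<in> borel_measurable M"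
    using measurable_restrict_space1 by blast
qed

lemma integrable_half_pow: "integrable M (half_pow t0 m)"
  by (rule integrable_const_bound[of _ 1])
     (auto intro: borel_measurable_circle simp: norm_half_pow norm_eq_1_of_space)

text \<open>On the circle the power has modulus 1, and w - z has modulus at least |1 - |z||.\<close>

lemma norm_cauchy_kernel_le:
  assumes "cmod z \<noteq> 1" "w \<in> space M"
  shows "cmod (half_pow t0 m w / (w - z)) \<le> 1 / \<bar>1 - cmod z\<bar>"
proof -
  have "\<bar>1 - cmod z\<bar> \<le> cmod (w - z)"
    using norm_triangle_ineq3[of w z] norm_eq_1_of_space[OF assms(2)] by simp
  then show ?thesis
    using assms by (simp add: norm_divide norm_half_pow norm_eq_1_of_space frac_le)
qed

lemma integrable_cauchy_kernel:
  assumes "cmod z \<noteq> 1"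
  shows "integrable M (\<lambda>w. half_pow t0 m w / (w - z))"
  by (rule integrable_const_bound[of _ "1 / \<bar>1 - cmod z\<bar>"])
     (use norm_cauchy_kernel_le[OF assms] in \<open>auto intro!: borel_measurable_circle\<close>)

lemma norm_half_cauchy_le:
  assumes "cmod z \<noteq> 1"
  shows "cmod (half_cauchy t0 M m z) \<le> 1 / \<bar>1 - cmod z\<bar>"
proof -
  have "cmod (half_cauchy t0 M m z) \<le> (\<integral>w. cmod (half_pow t0 m w / (w - z)) \<partial>M)"
    unfolding half_cauchy_def by (rule integral_norm_bound)
  also have "\<dots> \<le> 1 / \<bar>1 - cmod z\<bar>"
    by (rule integral_le_const)
       (use norm_cauchy_kernel_le[OF assms] integrable_cauchy_kernel[OF assms] in auto)
  finally show ?thesis .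
qed

text \<open>Near 0 the point z keeps away from the circle, so the Cauchy transform is bounded and
  the power in front decides the order.\<close>

lemma half_pow_half_cauchy_bigo_at_0:
  "(\<lambda>z. half_pow t0 r z * half_cauchy t0 M m z) \<in> O[at 0](half_pow t0 r)"
proof -
  have "\<forall>\<^sub>F z in at (0::complex). cmod z < 1 / 2"
    by (auto simp: eventually_at intro!: exI[of _ "1 / 2"])
  then have "\<forall>\<^sub>F z in at 0. norm (half_cauchy t0 M m z) \<le> 2 * norm (1 :: complex)"
  proof eventually_elim
    case (elim z)
    have "cmod (half_cauchy t0 M m z) \<le> 1 / \<bar>1 - cmod z\<bar>"
      using elim by (intro norm_half_cauchy_le) auto
    also have "\<dots> \<le> 2" using elim by (simp add: field_simps)
    finally show ?case by simp
  qed
  then have "half_cauchy t0 M m \<in> O[at 0](\<lambda>_. 1)" by (rule bigoI)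
  then show ?thesis using landau_o.big.mult[OF landau_o.big_refl[of "half_pow t0 r"]] by fastforce
qed

text \<open>At infinity the Cauchy transform is bounded by a multiple of 1/|z|, which is -2 in
  doubled exponents. This is the source of the shift in \<open>- n - 2\<close>.\<close>

lemma half_pow_half_cauchy_bigo_at_infinity:
  "(\<lambda>z. half_pow t0 r z * half_cauchy t0 M m z) \<in> O[at_infinity](half_pow t0 (r - 2))"
proof -
  have ev: "\<forall>\<^sub>F z in at_infinity. cmod z \<ge> 2"
    by (auto simp: eventually_at_infinity)
  then have "\<forall>\<^sub>F z in at_infinity. norm (half_cauchy t0 M m z) \<le> 2 * norm (half_pow t0 (- 2) z)"
  proof eventually_elim
    case (elim z)
    have "cmod (half_cauchy t0 M m z) \<le> 1 / \<bar>1 - cmod z\<bar>"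
      using elim by (intro norm_half_cauchy_le) auto
    also have "\<dots> \<le> 2 / cmod z" using elim by (subst frac_le_eq) (auto intro!: divide_nonpos_pos mult_pos_pos)
    finally show ?case by (simp add: half_pow_minus_2 norm_inverse divide_inverse)
  qed
  then have "half_cauchy t0 M m \<in> O[at_infinity](half_pow t0 (- 2))" by (rule bigoI)
  then have "(\<lambda>z. half_pow t0 r z * half_cauchy t0 M m z)
      \<in> O[at_infinity](\<lambda>z. half_pow t0 r z * half_pow t0 (- 2) z)"
    by (intro landau_o.big.mult landau_o.big_refl)
  also have "(\<lambda>z. half_pow t0 r z * half_pow t0 (- 2) z) \<in> O[at_infinity](half_pow t0 (r - 2))"
  proof (rule bigoI[of _ 1])
    show "\<forall>\<^sub>F z in at_infinity. norm (half_pow t0 r z * half_pow t0 (- 2) z) \<le> 1 * norm (half_pow t0 (r - 2) z)"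
      using ev
    proof eventually_elim
      case (elim z)
      then show ?case using half_pow_add[of z t0 r "- 2"] by fastforce
    qed
  qed
  finally show ?thesis .
qed

text \<open>The geometric expansion of the Cauchy kernel with an exact remainder. Read from left to
  right it expands at \<open>0\<close>, read from right to left it expands at \<open>\<infinity>\<close>.\<close>

lemma half_cauchy_shift:
  assumes z: "z \<noteq> 0" "cmod z \<noteq> 1" and ab: "a \<le> b" "even (b - a)"
  shows "half_pow t0 a z * half_cauchy t0 M (m + 2 - a) z =
    (\<Sum>q\<in>half_exps a (b - 2). half_moment t0 M (m - q) * half_pow t0 q z) +
    half_pow t0 b z * half_cauchy t0 M (m + 2 - b) z"
proof -
  have "half_pow t0 a z * half_cauchy t0 M (m + 2 - a) z =
      (\<integral>w. half_pow t0 a z * (half_pow t0 (m + 2 - a) w / (w - z)) \<partial>M)"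
    by (simp add: half_cauchy_def del: times_divide_eq_right)
  also have "\<dots> = (\<integral>w. (\<Sum>q\<in>half_exps a (b - 2). half_pow t0 (m - q) w * half_pow t0 q z) +
      half_pow t0 b z * (half_pow t0 (m + 2 - b) w / (w - z)) \<partial>M)"
  proof (rule Bochner_Integration.integral_cong[OF refl])
    fix w assume "w \<in> space M"
    then have w: "w \<noteq> 0" "w \<noteq> z" using norm_eq_1_of_space z by fastforce+
    let ?x = "branch_sqrt t0 z" and ?y = "branch_sqrt t0 w"
    \<comment> \<open>Factoring out w^(m/2) leaves the telescoping sum in the two square roots,
      whose squares w and z differ because z is off the circle.\<close>
    have "(\<Sum>q\<in>half_exps a (b - 2). half_pow t0 (m - q) w * half_pow t0 q z) =
        ?y powi m * (\<Sum>q\<in>half_exps a (b - 2). ?x powi q * ?y powi (- q))"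
      using w by (simp add: sum_distrib_left half_pow_def power_int_diff power_int_minus field_simps)
    also have "\<dots> = ?y powi m * (?x powi a * ?y powi (2 - a) - ?x powi b * ?y powi (2 - b)) / (w - z)"
      using w z ab by (subst half_exps_telescope) auto
    also have "\<dots> = half_pow t0 a z * (half_pow t0 (m + 2 - a) w / (w - z)) -
        half_pow t0 b z * (half_pow t0 (m + 2 - b) w / (w - z))"
    proof -
      have "half_pow t0 (m + 2 - q) w = ?y powi m * ?y powi (2 - q)" for q
        using w power_int_add[of ?y m "2 - q"] by (simp add: half_pow_def add_diff_eq)
      then show ?thesis
        by (simp add: half_pow_def diff_divide_distrib right_diff_distrib mult.left_commute)
    qed
    finally show "half_pow t0 a z * (half_pow t0 (m + 2 - a) w / (w - z)) =
        (\<Sum>q\<in>half_exps a (b - 2). half_pow t0 (m - q) w * half_pow t0 q z) +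
        half_pow t0 b z * (half_pow t0 (m + 2 - b) w / (w - z))"
      by simp
  qed
  also have "\<dots> = (\<Sum>q\<in>half_exps a (b - 2). \<integral>w. half_pow t0 (m - q) w * half_pow t0 q z \<partial>M) +
      (\<integral>w. half_pow t0 b z * (half_pow t0 (m + 2 - b) w / (w - z)) \<partial>M)"
    by (subst Bochner_Integration.integral_add)
       (auto simp: integrable_half_pow integrable_cauchy_kernel[OF z(2)]
          simp del: times_divide_eq_right
          intro!: Bochner_Integration.integral_sum Bochner_Integration.integrable_sum
            integrable_mult_left integrable_mult_right)
  finally show ?thesis by (simp add: half_moment_def half_cauchy_def del: times_divide_eq_right)
qed

text \<open>Expresses orthogonality linearly in the coefficients, with moments as entries. Exponents
  may be added because 0 is not on the circle.\<close>

lemma integral_half_sum_half_pow: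
  "(\<integral>w. half_sum t0 a b c w * half_pow t0 (- k) w \<partial>M) =
    (\<Sum>m\<in>half_exps a b. c m * half_moment t0 M (m - k))"
proof -
  have "(\<integral>w. half_sum t0 a b c w * half_pow t0 (- k) w \<partial>M) =
      (\<integral>w. (\<Sum>m\<in>half_exps a b. c m * half_pow t0 (m - k) w) \<partial>M)"
  proof (rule Bochner_Integration.integral_cong[OF refl])
    fix w assume "w \<in> space M"
    then have "w \<noteq> 0" using norm_eq_1_of_space by force
    then show "half_sum t0 a b c w * half_pow t0 (- k) w = (\<Sum>m\<in>half_exps a b. c m * half_pow t0 (m - k) w)"
      using half_pow_add[of w t0 _ "- k"] by (simp add: half_sum_def sum_distrib_right mult.assoc)
  qed
  also have "\<dots> = (\<Sum>m\<in>half_exps a b. c m * half_moment t0 M (m - k))"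
    by (subst Bochner_Integration.integral_sum) (auto simp: half_moment_def integrable_half_pow)
  finally show ?thesis .
qed

lemma G_fun_eq: "G_fun t0 M z = half_pow t0 1 z * half_cauchy t0 M 1 z"
proof -
  have "G_fun t0 M z = (\<integral>w. half_pow t0 1 z * (half_pow t0 1 w / (w - z)) \<partial>M)"
    unfolding G_fun_def by (intro Bochner_Integration.integral_cong) (auto simp: half_pow_def)
  then show ?thesis by (simp add: half_cauchy_def del: times_divide_eq_right)
qed

text \<open>The kernel splits as (w + z)/(w - z) = 1 + 2 z/(w - z), and the constant integrates to 1
  because the total mass is 1.\<close>

lemma F_fun_eq:
  assumes "cmod z \<noteq> 1"
  shows "F_fun M z = 1 + 2 * (half_pow t0 2 z * half_cauchy t0 M 0 z)"
proof -
  have "F_fun M z = (\<integral>w. 1 + 2 * (half_pow t0 2 z * (half_pow t0 0 w / (w - z))) \<partial>M)"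
    unfolding F_fun_def
  proof (rule Bochner_Integration.integral_cong[OF refl])
    fix w assume "w \<in> space M"
    then have "w \<noteq> z" using norm_eq_1_of_space assms by auto
    then show "(w + z) / (w - z) = 1 + 2 * (half_pow t0 2 z * (half_pow t0 0 w / (w - z)))"
      by (simp add: half_pow_2 field_simps)
  qed
  also have "\<dots> = 1 + 2 * (half_pow t0 2 z * half_cauchy t0 M 0 z)"
    using integrable_cauchy_kernel[OF assms, of t0 0]
    by (subst Bochner_Integration.integral_add)
       (auto simp: half_cauchy_def prob_space simp del: times_divide_eq_right
          intro!: integrable_mult_right)
  finally show ?thesis .
qed

end

section \<open>Linear operations on sums of half-integer powers\<close>

lemma half_sum_add: "half_sum t0 a b c z + half_sum t0 a b d z = half_sum t0 a b (\<lambda>q. c q + d q) z"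
  by (simp add: half_sum_def algebra_simps sum.distrib)

lemma half_sum_diff: "half_sum t0 a b c z - half_sum t0 a b d z = half_sum t0 a b (\<lambda>q. c q - d q) z"
  by (simp add: half_sum_def algebra_simps sum_subtractf)

lemma half_sum_cmult: "k * half_sum t0 a b c z = half_sum t0 a b (\<lambda>q. k * c q) z"
  by (simp add: half_sum_def sum_distrib_left mult.assoc)

lemma bigo_cong_diff:
  assumes "(\<lambda>z. f z - g z) \<in> O[F](h)"
  shows "f \<in> O[F](h) \<longleftrightarrow> g \<in> O[F](h)"
  using sum_in_bigo(2)[OF _ assms, of f] sum_in_bigo(1)[OF assms, of g] by auto

lemma half_sum_swap:
  "(\<Sum>m\<in>A. c m * half_sum t0 a b (f m) z) = half_sum t0 a b (\<lambda>q. \<Sum>m\<in>A. c m * f m q) z"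
  unfolding half_sum_def sum_distrib_left sum_distrib_right
  by (subst sum.swap) (simp add: mult.assoc)

lemma half_sum_mono_neutral:
  assumes "half_exps a' b' \<subseteq> half_exps a b"
    and "\<And>q. q \<in> half_exps a b - half_exps a' b' \<Longrightarrow> c q = 0"
  shows "half_sum t0 a b c z = half_sum t0 a' b' c z"
  unfolding half_sum_def using assms by (intro sum.mono_neutral_right) auto

section \<open>The two-point approximation problem for a single measure\<close>

text \<open>With \<open>e = 1\<close> the kernel is that of \<open>G\<close>, with \<open>e = 2\<close> it is that of \<open>(F - 1) / 2\<close>.\<close>

lemma two_point_approx_iff_orthogonal:
  fixes t0 :: real and N n e :: int and c :: "int \<Rightarrow> complex"
  assumes M: "prob_on_circle M"
    and n: "0 \<le> n" "n \<le> N - 2 + e" and e: "1 \<le> e" and par: "even (N - n - e)"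
  defines "\<phi> \<equiv> half_sum t0 (- N) N c"
  defines "K \<equiv> \<lambda>z. half_pow t0 e z * half_cauchy t0 M (2 - e) z"
  shows "(\<exists>\<psi>\<in>half_span t0 (- N + 2 - e) (N - 2 + e).
      (\<lambda>z. \<phi> z * K z + \<psi> z) \<in> O[at 0](half_pow t0 n) \<and>
      (\<lambda>z. \<phi> z * K z + \<psi> z) \<in> O[at_infinity](half_pow t0 (- n - 2))) \<longleftrightarrow>
    (\<forall>k\<in>half_exps (- n) (n - 2). (\<integral>w. \<phi> w * half_pow t0 (- k) w \<partial>M) = 0)"
proof -
  \<comment> \<open>The span is symmetric about 0. Its top \<open>b\<close> is the highest exponent
    of phi K at infinity, and \<open>1 \<le> e\<close> keeps the lowest exponent
    \<open>- N + e\<close> at 0 from falling below \<open>a\<close>.\<close>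
  define a where "a = - N + 2 - e"
  define b where "b = N - 2 + e"
  define mom where "mom = half_moment t0 M"
  define X where "X = half_exps (- N) N"
  \<comment> \<open>For the monomial z^(m/2), \<open>f m\<close> holds the coefficients below
    \<open>n\<close> of its product with K at 0, and \<open>g m\<close> holds, with opposite sign,
    those from \<open>- n\<close> on at infinity.\<close>
  define f where "f m q = (if m + e \<le> q \<and> q < n then mom (m - q) else 0)" for m q
  define g where "g m q = (if q < m + e \<and> - n \<le> q then mom (m - q) else 0)" for m q
  define A where "A q = (\<Sum>m\<in>X. c m * f m q)" for q
  define B where "B q = (\<Sum>m\<in>X. c m * g m q)" for q
  have X: "- N \<le> m \<and> m \<le> N \<and> even (m - N)" if "m \<in> X" for m
    using that by (auto simp: X_def half_exps_def)
  have \<phi>K: "\<phi> z * K z = (\<Sum>m\<in>X. c m * (half_pow t0 (m + e) z * half_cauchy t0 M (2 - e) z))"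
    if "z \<noteq> 0" for z
    using that by (simp add: \<phi>_def K_def half_sum_def X_def sum_distrib_right half_pow_add mult.assoc)
  \<comment> \<open>For \<open>q\<close> in this range exactly one of \<open>m + e \<le> q\<close>
    and \<open>q < m + e\<close> holds, so \<open>f m q + g m q\<close> is the whole moment
    \<open>mom (m - q)\<close>.\<close>
  have AB: "A q + B q = (\<integral>w. \<phi> w * half_pow t0 (- q) w \<partial>M)" if "- n \<le> q" "q < n" for q
    unfolding \<phi>_def integral_half_sum_half_pow[OF M] A_def B_def X_def sum.distrib[symmetric]
    using that by (intro sum.cong) (auto simp: f_def g_def mom_def)

  \<comment> \<open>\<open>A\<close> is the part below \<open>n\<close> of the expansion of phi K at
    0. The claim is proved monomial by monomial.\<close>
  have O0: "(\<lambda>z. \<phi> z * K z - half_sum t0 a b A z) \<in> O[at 0](half_pow t0 n)"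
  proof -
    have summand: "(\<lambda>z. half_pow t0 (m + e) z * half_cauchy t0 M (2 - e) z - half_sum t0 a b (f m) z)
        \<in> O[at 0](half_pow t0 n)" (is "?T \<in> _") if "m \<in> X" for m
    proof (cases "m + e \<le> n")
      case True
      have "\<forall>\<^sub>F z in at (0::complex). z \<noteq> 0 \<and> cmod z < 1"
        by (auto simp: eventually_at intro!: exI[of _ 1])
      then have "\<forall>\<^sub>F z in at 0. half_pow t0 n z * half_cauchy t0 M (m + 2 - n) z = ?T z"
      proof eventually_elim
        case (elim z)
        have "half_sum t0 a b (f m) z = half_sum t0 (m + e) (n - 2) (f m) z"
          using X[OF that] n e par
          by (intro half_sum_mono_neutral) (auto simp: half_exps_def a_def b_def f_def; presburger)+
        also have "\<dots> = (\<Sum>q\<in>half_exps (m + e) (n - 2). mom (m - q) * half_pow t0 q z)"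
          unfolding half_sum_def by (intro sum.cong) (auto simp: f_def half_exps_def)
        finally have sum: "half_sum t0 a b (f m) z = \<dots>" .
        have "even (n - (m + e))" using X[OF that] par by presburger
        \<comment> \<open>Left to right from \<open>m + e\<close> up to \<open>n\<close>: removing
          the finite sum leaves a remainder with the power \<open>n\<close> in front.\<close>
        from half_cauchy_shift[OF M _ _ True this, of z t0 m] elim sum show ?case
          by (simp add: mom_def)
      qed
      then show ?thesis
        using half_pow_half_cauchy_bigo_at_0[OF M, of t0 n "m + 2 - n"]
        by (rule landau_o.big.in_cong[THEN iffD1])
    next
      \<comment> \<open>The product already has order above \<open>n\<close>, so nothing has to be
        subtracted.\<close>
      case False
      then have "half_sum t0 a b (f m) z = 0" for z
        unfolding half_sum_def by (intro sum.neutral) (auto simp: f_def)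
      then show ?thesis
        using landau_o.big_trans[OF half_pow_half_cauchy_bigo_at_0[OF M]
            half_pow_bigo_at_0[of n "m + e" t0]] False by simp
    qed
    have "(\<lambda>z. \<Sum>m\<in>X. c m * (half_pow t0 (m + e) z * half_cauchy t0 M (2 - e) z - half_sum t0 a b (f m) z))
        \<in> O[at 0](half_pow t0 n)"
      using summand by (intro big_sum_in_bigo) simp
    moreover have "\<forall>\<^sub>F z in at 0.
        (\<Sum>m\<in>X. c m * (half_pow t0 (m + e) z * half_cauchy t0 M (2 - e) z - half_sum t0 a b (f m) z)) =
        \<phi> z * K z - half_sum t0 a b A z"
      by (auto simp: eventually_at_filter \<phi>K right_diff_distrib sum_subtractf half_sum_swap A_def[abs_def])
    ultimately show ?thesis by (rule landau_o.big.in_cong[THEN iffD1, rotated])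
  qed

  \<comment> \<open>The coefficients at infinity are those of \<open>- B\<close>, since the finite
    sum of the shift identity changes sides.\<close>
  have Oinf: "(\<lambda>z. \<phi> z * K z - half_sum t0 a b (\<lambda>q. - B q) z) \<in> O[at_infinity](half_pow t0 (- n - 2))"
  proof -
    have summand: "(\<lambda>z. half_pow t0 (m + e) z * half_cauchy t0 M (2 - e) z + half_sum t0 a b (g m) z)
        \<in> O[at_infinity](half_pow t0 (- n - 2))" (is "?T \<in> _") if "m \<in> X" for m
    proof (cases "- n \<le> m + e")
      case True
      have "\<forall>\<^sub>F z in at_infinity. cmod z \<ge> 2"
        by (auto simp: eventually_at_infinity)
      then have "\<forall>\<^sub>F z in at_infinity. half_pow t0 (- n) z * half_cauchy t0 M (m + 2 + n) z = ?T z"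
      proof eventually_elim
        case (elim z)
        have z: "z \<noteq> 0" "cmod z \<noteq> 1" using elim by auto
        have "half_sum t0 a b (g m) z = half_sum t0 (- n) (m + e - 2) (g m) z"
        proof (rule half_sum_mono_neutral)
          show "half_exps (- n) (m + e - 2) \<subseteq> half_exps a b"
          proof
            fix q assume "q \<in> half_exps (- n) (m + e - 2)"
            then have q: "- n \<le> q" "q \<le> m + e - 2" "even (q - - n)"
              unfolding half_exps_def by blast+
            have "even (q - a)" using q(3) par unfolding a_def by presburger
            moreover have "a \<le> q" "q \<le> b" using q X[OF that] n by (auto simp: a_def b_def)
            ultimately show "q \<in> half_exps a b" by (simp add: half_exps_def)
          qed
        next
          fix q assume q: "q \<in> half_exps a b - half_exps (- n) (m + e - 2)"
          have "\<not> (q < m + e \<and> - n \<le> q)"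
          proof
            assume *: "q < m + e \<and> - n \<le> q"
            have "even (q - a)" using q by (simp add: half_exps_def)
            then have "even (q + n)" "even (m + e - q)"
              using par X[OF that] unfolding a_def by presburger+
            moreover from this(2) * have "q \<le> m + e - 2" by presburger
            ultimately have "q \<in> half_exps (- n) (m + e - 2)" using * by (simp add: half_exps_def)
            with q show False by simp
          qed
          then show "g m q = 0" by (auto simp: g_def)
        qed
        also have "\<dots> = (\<Sum>q\<in>half_exps (- n) (m + e - 2). mom (m - q) * half_pow t0 q z)"
          unfolding half_sum_def by (intro sum.cong) (auto simp: g_def half_exps_def)
        finally have sum: "half_sum t0 a b (g m) z = \<dots>" .
        have "even (m + e - - n)" using X[OF that] par by presburger
        \<comment> \<open>Right to left from \<open>m + e\<close> down to \<open>- n\<close>: the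
          remainder is the power \<open>- n\<close> times a Cauchy transform, hence of order
          \<open>- n - 2\<close>.\<close>
        from half_cauchy_shift[OF M z True this, of t0 m] sum show ?case
          by (simp add: mom_def)
      qed
      then show ?thesis
        using half_pow_half_cauchy_bigo_at_infinity[OF M, of t0 "- n" "m + 2 + n"]
        by (rule landau_o.big.in_cong[THEN iffD1])
    next
      case False
      then have "half_sum t0 a b (g m) z = 0" for z
        unfolding half_sum_def by (intro sum.neutral) (auto simp: g_def)
      then show ?thesis
        using landau_o.big_trans[OF half_pow_half_cauchy_bigo_at_infinity[OF M]
            half_pow_bigo_at_infinity[of "m + e - 2" "- n - 2" t0]] False by simp
    qed
    have "(\<lambda>z. \<Sum>m\<in>X. c m * (half_pow t0 (m + e) z * half_cauchy t0 M (2 - e) z + half_sum t0 a b (g m) z))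
        \<in> O[at_infinity](half_pow t0 (- n - 2))"
      using summand by (intro big_sum_in_bigo) simp
    moreover have "\<forall>\<^sub>F z in at_infinity.
        (\<Sum>m\<in>X. c m * (half_pow t0 (m + e) z * half_cauchy t0 M (2 - e) z + half_sum t0 a b (g m) z)) =
        \<phi> z * K z - half_sum t0 a b (\<lambda>q. - B q) z"
      using eventually_not_equal_at_infinity[of 0]
    proof eventually_elim
      case (elim z)
      have "half_sum t0 a b (\<lambda>q. - B q) z = - half_sum t0 a b B z"
        by (simp add: half_sum_def sum_negf)
      with elim show ?case
        by (simp add: \<phi>K distrib_left sum.distrib half_sum_swap B_def[abs_def])
    qed
    ultimately show ?thesis by (rule landau_o.big.in_cong[THEN iffD1, rotated])
  qed

  have at_0: "(\<lambda>z. \<phi> z * K z + half_sum t0 a b d z) \<in> O[at 0](half_pow t0 n) \<longleftrightarrow>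
      (\<forall>q\<in>half_exps a b. q < n \<longrightarrow> A q + d q = 0)" for d
  proof -
    have "(\<lambda>z. (\<phi> z * K z + half_sum t0 a b d z) - half_sum t0 a b (\<lambda>q. A q + d q) z)
        \<in> O[at 0](half_pow t0 n)"
      using O0 by (simp add: half_sum_add[symmetric])
    from bigo_cong_diff[OF this] show ?thesis by (simp add: half_sum_bigo_at_0_iff)
  qed
  \<comment> \<open>Exponents in the span have the parity of \<open>n\<close>, so
    \<open>- n - 2 < q\<close> means \<open>- n \<le> q\<close>.\<close>
  have at_inf: "(\<lambda>z. \<phi> z * K z + half_sum t0 a b d z) \<in> O[at_infinity](half_pow t0 (- n - 2)) \<longleftrightarrow>
      (\<forall>q\<in>half_exps a b. - n - 2 < q \<longrightarrow> - B q + d q = 0)" for d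
  proof -
    have "(\<lambda>z. (\<phi> z * K z + half_sum t0 a b d z) - half_sum t0 a b (\<lambda>q. - B q + d q) z)
        \<in> O[at_infinity](half_pow t0 (- n - 2))"
      using Oinf by (simp only: half_sum_add[symmetric]) simp
    from bigo_cong_diff[OF this] show ?thesis by (simp only: half_sum_bigo_at_infinity_iff)
  qed
  \<comment> \<open>The exponents constrained both at 0 and at infinity are exactly those of the
    orthogonality conditions.\<close>
  have sub: "k \<in> half_exps (- n) (n - 2) \<longleftrightarrow> k \<in> half_exps a b \<and> - n - 2 < k \<and> k < n" for k
    using n par by (auto simp: half_exps_def a_def b_def; presburger)
  show ?thesis
    unfolding a_def[symmetric] b_def[symmetric]
  proof (intro iffI ballI)
    fix k assume k: "k \<in> half_exps (- n) (n - 2)"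
    assume "\<exists>\<psi>\<in>half_span t0 a b.
      (\<lambda>z. \<phi> z * K z + \<psi> z) \<in> O[at 0](half_pow t0 n) \<and>
      (\<lambda>z. \<phi> z * K z + \<psi> z) \<in> O[at_infinity](half_pow t0 (- n - 2))"
    then obtain d where "\<forall>q\<in>half_exps a b. q < n \<longrightarrow> A q + d q = 0"
        "\<forall>q\<in>half_exps a b. - n - 2 < q \<longrightarrow> - B q + d q = 0"
      by (auto simp: half_span_def at_0 at_inf)
    with k have "A k + d k = 0" "- B k + d k = 0" by (auto simp: sub)
    then have "A k + B k = 0" by algebra
    with AB[of k] k show "(\<integral>w. \<phi> w * half_pow t0 (- k) w \<partial>M) = 0"
      by (auto simp: half_exps_def)
  next
    assume orth: "\<forall>k\<in>half_exps (- n) (n - 2). (\<integral>w. \<phi> w * half_pow t0 (- k) w \<partial>M) = 0"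
    \<comment> \<open>Below \<open>n\<close> the condition at 0 prescribes \<open>- A\<close>. From
      \<open>n\<close> on only the condition at infinity applies, and it prescribes
      \<open>B\<close>. On the overlap orthogonality makes the two values equal.\<close>
    define d where "d q = (if q < n then - A q else B q)" for q
    have "- A q = B q" if "q \<in> half_exps a b" "- n - 2 < q" "q < n" for q
    proof -
      have "q \<in> half_exps (- n) (n - 2)" using that by (simp add: sub)
      with orth AB[of q] have "A q + B q = 0" by (auto simp: half_exps_def)
      then show ?thesis by algebra
    qed
    then have "(\<lambda>z. \<phi> z * K z + half_sum t0 a b d z) \<in> O[at 0](half_pow t0 n)"
      "(\<lambda>z. \<phi> z * K z + half_sum t0 a b d z) \<in> O[at_infinity](half_pow t0 (- n - 2))"
      unfolding at_0 at_inf by (auto simp: d_def)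
    then show "\<exists>\<psi>\<in>half_span t0 a b.
      (\<lambda>z. \<phi> z * K z + \<psi> z) \<in> O[at 0](half_pow t0 n) \<and>
      (\<lambda>z. \<phi> z * K z + \<psi> z) \<in> O[at_infinity](half_pow t0 (- n - 2))"
      by (intro bexI[of _ "half_sum t0 a b d"]) (auto simp: half_span_def)
  qed
qed

text \<open>Since F = 1 + 2 K with the kernel K of \<open>e = 2\<close>, phi F + psi = 2 (phi K +
  (phi + psi)/2). As phi lies in the span, psi -> (phi + psi)/2 is a bijection of the span, and the
  problem for F becomes that for K.\<close>

lemma F_approx_iff_orthogonal:
  fixes t0 :: real and N n :: int and c :: "int \<Rightarrow> complex"
  assumes M: "prob_on_circle M" and n: "0 \<le> n" "n \<le> N" and par: "even (N - n)"
  defines "\<phi> \<equiv> half_sum t0 (- N) N c"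
  shows "(\<exists>\<psi>\<in>half_span t0 (- N) N.
      (\<lambda>z. \<phi> z * F_fun M z + \<psi> z) \<in> O[at 0](half_pow t0 n) \<and>
      (\<lambda>z. \<phi> z * F_fun M z + \<psi> z) \<in> O[at_infinity](half_pow t0 (- n - 2))) \<longleftrightarrow>
    (\<forall>k\<in>half_exps (- n) (n - 2). (\<integral>w. \<phi> w * half_pow t0 (- k) w \<partial>M) = 0)"
proof -
  define K where "K z = half_pow t0 2 z * half_cauchy t0 M 0 z" for z
  have F: "\<phi> z * F_fun M z + \<psi> z = 2 * (\<phi> z * K z + (\<phi> z + \<psi> z) / 2)" if "cmod z \<noteq> 1" for z \<psi>
    using F_fun_eq[OF M that, of t0] by (simp add: K_def distrib_left add_divide_distrib)
  \<comment> \<open>The formula for F is used off the circle only, and both filters avoid the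
    circle.\<close>
  have ev0: "\<forall>\<^sub>F z in at (0::complex). cmod z \<noteq> 1"
    by (auto simp: eventually_at intro!: exI[of _ 1])
  have evinf: "\<forall>\<^sub>F z in at_infinity. cmod (z::complex) \<noteq> 1"
    by (auto simp: eventually_at_infinity intro!: exI[of _ 2])
  have O_iff: "(\<lambda>z. \<phi> z * F_fun M z + \<psi> z) \<in> O[E](h) \<longleftrightarrow>
      (\<lambda>z. \<phi> z * K z + (\<phi> z + \<psi> z) / 2) \<in> O[E](h)"
    if "\<forall>\<^sub>F z in E. cmod z \<noteq> 1" for E \<psi> h
  proof -
    have "(\<lambda>z. \<phi> z * F_fun M z + \<psi> z) \<in> O[E](h) \<longleftrightarrow>
        (\<lambda>z. 2 * (\<phi> z * K z + (\<phi> z + \<psi> z) / 2)) \<in> O[E](h)"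
      by (rule landau_o.big.in_cong) (use that in eventually_elim, rule F)
    then show ?thesis by (simp only: cmult_in_bigo_iff) simp
  qed
  \<comment> \<open>Stated for every predicate \<open>P\<close>, so that both growth conditions pass
    through the substitution together.\<close>
  have "(\<exists>\<psi>\<in>half_span t0 (- N) N. P (\<lambda>z. (\<phi> z + \<psi> z) / 2)) \<longleftrightarrow> (\<exists>\<psi>\<in>half_span t0 (- N) N. P \<psi>)" for P
  proof (intro iffI; elim bexE)
    fix \<psi> assume \<psi>: "\<psi> \<in> half_span t0 (- N) N"
    then obtain d where d: "\<psi> = half_sum t0 (- N) N d" by (auto simp: half_span_def)
    { assume "P (\<lambda>z. (\<phi> z + \<psi> z) / 2)"
      moreover have "(\<lambda>z. (\<phi> z + \<psi> z) / 2) = half_sum t0 (- N) N (\<lambda>q. 1 / 2 * (c q + d q))"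
        unfolding half_sum_cmult[symmetric] half_sum_add[symmetric] by (simp add: d \<phi>_def)
      ultimately show "\<exists>\<psi>\<in>half_span t0 (- N) N. P \<psi>" by (auto simp: half_span_def) }
    { assume "P \<psi>"
      define \<psi>' where "\<psi>' = half_sum t0 (- N) N (\<lambda>q. 2 * d q - c q)"
      have "(\<lambda>z. (\<phi> z + \<psi>' z) / 2) = \<psi>"
        by (simp add: fun_eq_iff d \<phi>_def \<psi>'_def flip: half_sum_cmult half_sum_diff)
      with \<open>P \<psi>\<close> have "P (\<lambda>z. (\<phi> z + \<psi>' z) / 2)" by simp
      then show "\<exists>\<psi>\<in>half_span t0 (- N) N. P (\<lambda>z. (\<phi> z + \<psi> z) / 2)"
        by (intro bexI[of _ \<psi>']) (auto simp: half_span_def \<psi>'_def) }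
  qed
  from this[of "\<lambda>\<psi>. (\<lambda>z. \<phi> z * K z + \<psi> z) \<in> O[at 0](half_pow t0 n) \<and>
      (\<lambda>z. \<phi> z * K z + \<psi> z) \<in> O[at_infinity](half_pow t0 (- n - 2))"]
  have "(\<exists>\<psi>\<in>half_span t0 (- N) N.
      (\<lambda>z. \<phi> z * F_fun M z + \<psi> z) \<in> O[at 0](half_pow t0 n) \<and>
      (\<lambda>z. \<phi> z * F_fun M z + \<psi> z) \<in> O[at_infinity](half_pow t0 (- n - 2))) \<longleftrightarrow>
    (\<exists>\<psi>\<in>half_span t0 (- N) N.
      (\<lambda>z. \<phi> z * K z + \<psi> z) \<in> O[at 0](half_pow t0 n) \<and>
      (\<lambda>z. \<phi> z * K z + \<psi> z) \<in> O[at_infinity](half_pow t0 (- n - 2)))"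
    by (simp only: O_iff[OF ev0] O_iff[OF evinf])
  also have "\<dots> \<longleftrightarrow> (\<forall>k\<in>half_exps (- n) (n - 2). (\<integral>w. \<phi> w * half_pow t0 (- k) w \<partial>M) = 0)"
    using two_point_approx_iff_orthogonal[OF M, of n N 2 t0 c] n par
    by (simp add: K_def \<phi>_def)
  finally show ?thesis .
qed

lemma G_approx_iff_orthogonal:
  fixes t0 :: real and N n :: int and c :: "int \<Rightarrow> complex"
  assumes M: "prob_on_circle M" and n: "0 \<le> n" "n \<le> N" and par: "odd (N - n)"
  defines "\<phi> \<equiv> half_sum t0 (- N) N c"
  shows "(\<exists>\<psi>\<in>half_span t0 (- N + 1) (N - 1).
      (\<lambda>z. \<phi> z * G_fun t0 M z + \<psi> z) \<in> O[at 0](half_pow t0 n) \<and>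
      (\<lambda>z. \<phi> z * G_fun t0 M z + \<psi> z) \<in> O[at_infinity](half_pow t0 (- n - 2))) \<longleftrightarrow>
    (\<forall>k\<in>half_exps (- n) (n - 2). (\<integral>w. \<phi> w * half_pow t0 (- k) w \<partial>M) = 0)"
proof -
  \<comment> \<open>This sharpens \<open>n \<le> N\<close> to \<open>n \<le> N - 1\<close>, the
    bound required for \<open>e = 1\<close>.\<close>
  have "n \<noteq> N" using par by auto
  then show ?thesis
    using two_point_approx_iff_orthogonal[OF M, of n N 1 t0 c] n par
    by (simp add: G_fun_eq[OF M] \<phi>_def)
qed

section \<open>Monic functions and systems of measures\<close>

text \<open>The exponent \<open>N\<close> does not occur among the lower ones, so the value of a
  coefficient family there can be set to 1 freely.\<close>

lemma half_monic_iff: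
  "half_monic t0 N \<phi> \<longleftrightarrow>
    (\<exists>\<kappa>. \<phi> = (\<lambda>z. half_pow t0 (int N) z + half_sum t0 (- int N) (int N - 2) \<kappa> z))"
proof -
  have exps: "half_exps (- int N) (int N) = insert (int N) (half_exps (- int N) (int N - 2))"
    unfolding half_exps_def by (auto; presburger)
  have split: "half_sum t0 (- int N) (int N) c z =
      c (int N) * half_pow t0 (int N) z + half_sum t0 (- int N) (int N - 2) c z" for c z
  proof -
    have "int N \<notin> half_exps (- int N) (int N - 2)" by (simp add: half_exps_def)
    then show ?thesis by (simp add: half_sum_def exps)
  qed
  have upd: "half_sum t0 (- int N) (int N - 2) (\<kappa>(int N := 1)) z = half_sum t0 (- int N) (int N - 2) \<kappa> z" for \<kappa> z
    unfolding half_sum_def by (intro sum.cong) (auto simp: half_exps_def)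
  show ?thesis
  proof
    assume "half_monic t0 N \<phi>"
    then obtain c where "\<phi> = half_sum t0 (- int N) (int N) c" "c (int N) = 1"
      by (auto simp: half_monic_def)
    then show "\<exists>\<kappa>. \<phi> = (\<lambda>z. half_pow t0 (int N) z + half_sum t0 (- int N) (int N - 2) \<kappa> z)"
      by (auto simp: split fun_eq_iff)
  next
    assume "\<exists>\<kappa>. \<phi> = (\<lambda>z. half_pow t0 (int N) z + half_sum t0 (- int N) (int N - 2) \<kappa> z)"
    then obtain \<kappa> where "\<phi> = (\<lambda>z. half_pow t0 (int N) z + half_sum t0 (- int N) (int N - 2) \<kappa> z)" by auto
    then have "\<phi> = half_sum t0 (- int N) (int N) (\<kappa>(int N := 1))"
      by (simp add: fun_eq_iff split upd)
    then show "half_monic t0 N \<phi>"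
      unfolding half_monic_def by (intro exI[of _ "\<kappa>(int N := 1)"]) simp
  qed
qed

text \<open>For fixed phi the conditions on the different psi_j are independent, so solvability is
  decided index by index and the solutions are collected by choice.\<close>

lemma ex_hybrid_solution_iff_orthogonal:
  fixes \<mu> :: "'r::finite \<Rightarrow> complex measure" and n :: "'r \<Rightarrow> nat"
  assumes \<mu>: "\<And>j. prob_on_circle (\<mu> j)"
    and \<phi>: "\<phi> \<in> half_span t0 (- int (index_size n)) (int (index_size n))"
  shows "(\<exists>\<psi>. hybrid_solution t0 \<mu> n \<phi> \<psi>) \<longleftrightarrow>
    (\<forall>j. \<forall>k\<in>half_exps (- int (n j)) (int (n j) - 2). (\<integral>z. \<phi> z * half_pow t0 (- k) z \<partial>\<mu> j) = 0)"
proof -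
  define N where "N = int (index_size n)"
  \<comment> \<open>The common shape of both parities, with \<open>H\<close> standing for F or
    G.\<close>
  define Q where "Q H a b j \<psi> \<longleftrightarrow> \<psi> \<in> half_span t0 a b \<and>
      (\<lambda>z. \<phi> z * H z + \<psi> z) \<in> O[at 0](half_pow t0 (int (n j))) \<and>
      (\<lambda>z. \<phi> z * H z + \<psi> z) \<in> O[at_infinity](half_pow t0 (- int (n j) - 2))" for H a b j \<psi>
  define R where "R j \<psi> \<longleftrightarrow> (if even (N - int (n j)) then Q (F_fun (\<mu> j)) (- N) N j \<psi>
      else Q (G_fun t0 (\<mu> j)) (- N + 1) (N - 1) j \<psi>)" for j \<psi>
  obtain c where c: "\<phi> = half_sum t0 (- N) N c" using \<phi> by (auto simp: half_span_def N_def)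
  have "n j \<le> index_size n" for j
    unfolding index_size_def by (rule member_le_sum) auto
  then have n: "0 \<le> int (n j)" "int (n j) \<le> N" for j by (simp_all add: N_def)
  have R: "(\<exists>\<psi>. R j \<psi>) \<longleftrightarrow> (\<forall>k\<in>half_exps (- int (n j)) (int (n j) - 2).
      (\<integral>z. \<phi> z * half_pow t0 (- k) z \<partial>\<mu> j) = 0)" for j
  proof (cases "even (N - int (n j))")
    case True
    then show ?thesis
      using F_approx_iff_orthogonal[OF \<mu> n True, of t0 c] by (simp add: R_def Q_def c Bex_def)
  next
    case False
    then show ?thesis
      using G_approx_iff_orthogonal[OF \<mu> n False, of t0 c] by (simp add: R_def Q_def c Bex_def)
  qed
  have "hybrid_solution t0 \<mu> n \<phi> \<psi> \<longleftrightarrow> (\<forall>j. R j (\<psi> j))" for \<psi>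
    using \<phi> unfolding hybrid_solution_def Let_def N_def[symmetric] R_def Q_def by auto
  then have "(\<exists>\<psi>. hybrid_solution t0 \<mu> n \<phi> \<psi>) \<longleftrightarrow> (\<forall>j. \<exists>\<psi>. R j \<psi>)"
    by (simp add: choice_iff)
  with R show ?thesis by simp
qed

text \<open>The equivalence holds for each single phi, so both problems have the same solution set,
  and existence and uniqueness carry over together.\<close>

lemma monic_hybrid_solution_iff_is_phi:
  fixes \<mu> :: "'r::finite \<Rightarrow> complex measure"
  assumes "\<And>j. prob_on_circle (\<mu> j)"
  shows "monic_hybrid_solution t0 \<mu> n \<phi> \<longleftrightarrow> is_phi t0 \<mu> n \<phi>"
proof -
  have "\<phi> \<in> half_span t0 (- int (index_size n)) (int (index_size n))" if "half_monic t0 (index_size n) \<phi>"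
    using that by (auto simp: half_monic_def half_span_def)
  with ex_hybrid_solution_iff_orthogonal[of \<mu> \<phi> t0 n, OF assms] show ?thesis
    unfolding monic_hybrid_solution_def is_phi_def Let_def half_monic_iff[symmetric] by blast
qed

theorem corollary6p9:
  fixes t0 :: real and \<mu> :: "'r::finite \<Rightarrow> complex measure" and n :: "'r \<Rightarrow> nat"
  assumes "\<And>j. prob_on_circle (\<mu> j)"
  shows "((\<exists>!\<phi>. monic_hybrid_solution t0 \<mu> n \<phi>) \<longleftrightarrow> phi_normal t0 \<mu> n) \<and>
    (phi_normal t0 \<mu> n \<longrightarrow>
      (\<forall>\<phi>. monic_hybrid_solution t0 \<mu> n \<phi> \<longleftrightarrow> \<phi> = phi_fun t0 \<mu> n))"
  unfolding monic_hybrid_solution_iff_is_phi[OF assms] phi_normal_def phi_fun_def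
  by (metis the1_equality theI')

end
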